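(* Let $\mathbf{F}$ be a fibration category in which all objects are cofibrant and $\ast$-fibrant and in which a morphism is a weak equivalence if and only if it is a homotopy equivalence. Call a morphism of $\mathbf{F}$ a cofibration if it has the left lifting property with respect to the trivial fibrations. Suppose that $\mathbf{F}$ has an initial object $\emptyset$, that the pushout of two morphisms one of which is a cofibration exists, and that for every object $X$ the morphism $(id_X,id_X):X\coprod X\to X$ admits a factorization into a cofibration followed by a weak equivalence. Then two morphisms of $\mathbf{F}$ are homotopic in the cofibration category $\mathbf{F}$ (with these cofibrations and the given weak equivalences) if and only if they are homotopic in the fibration category $\mathbf{F}$.
   Context: A fibration category (Baues) is a category with a final object $\ast$ and two classes of morphisms, weak equivalences and fibrations, such that (a trivial fibration being both a fibration and a weak equivalence): (F1) Isomorphisms are trivial fibrations; composites of two fibrations are fibrations; if two of $f$, $g$, $g\circ f$ are weak equivalences, so is the third. (F2) The pullback of two morphisms one of which is a fibration exists; fibrations and trivial fibrations are stable under base change; the base extension of a weak equivalence along a fibration is a weak equivalence. (F3) Every morphism factors as a weak equivalence followed by a fibration. (F4) For each object $X$ there is a trivial fibration $Y\to X$ with $Y$ cofibrant, meaning that every trivial fibration $E\to Y$ admits a section. $X$ is $\ast$-fibrant if $X\to\ast$ is a fibration. For $X$ cofibrant and $Y$ $\ast$-fibrant, two morphisms $f,g:X\to Y$ are homotopic in the fibration category if for some factorization of $(id_Y,id_Y):Y\to Y\times Y$ into a weak equivalence $Y\to P$ and a fibration $q:P\to Y\times Y$ there is $h:X\to P$ with $q\circ h=(f,g)$. A homotopy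 equivalence is a morphism invertible up to this relation. A cofibration category is the dual notion: a category with an initial object $\emptyset$ and classes of weak equivalences and cofibrations satisfying the duals (C1)-(C4) of (F1)-(F4); in particular an object $Y$ is fibrant if every trivial cofibration (cofibration that is a weak equivalence) $Y\to Q$ admits a retraction, and $X$ is $\emptyset$-cofibrant if $\emptyset\to X$ is a cofibration. Under the hypotheses of the claim, $\mathbf{F}$ is a cofibration category in which all objects are $\emptyset$-cofibrant and fibrant (so in particular the coproducts $X\coprod X$ exist). Two morphisms $f,g:X\to Y$ are homotopic in the cofibration category if for some factorization of $(id_X,id_X):X\coprod X\to X$ into a cofibration $j:X\coprod X\to Z$ followed by a weak equivalence $Z\to X$ there is $h:Z\to Y$ with $h\circ j=(f,g)$. *)

theory Defs
  imports Main
begin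

record ('o, 'm) cat =
  Obj :: "'o set"
  Arr :: "'m set"
  Dom :: "'m \<Rightarrow> 'o"
  Cod :: "'m \<Rightarrow> 'o"
  Id :: "'o \<Rightarrow> 'm"
  Comp :: "'m \<Rightarrow> 'm \<Rightarrow> 'm"  (infixl "\<cdot>\<index>" 70)

definition hom :: "('o, 'm, 'z) cat_scheme \<Rightarrow> 'o \<Rightarrow> 'o \<Rightarrow> 'm set" where
  "hom C X Y = {f \<in> Arr C. Dom C f = X \<and> Cod C f = Y}"

locale category =
  fixes C :: "('o, 'm, 'z) cat_scheme" (structure)
  assumes dom_obj: "f \<in> Arr C \<Longrightarrow> Dom C f \<in> Obj C"
    and cod_obj: "f \<in> Arr C \<Longrightarrow> Cod C f \<in> Obj C"
    and id_hom: "X \<in> Obj C \<Longrightarrow> Id C X \<in> hom C X X"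
    and comp_hom: "\<lbrakk>f \<in> hom C X Y; g \<in> hom C Y Z\<rbrakk> \<Longrightarrow> g \<cdot> f \<in> hom C X Z"
    and comp_id_right: "f \<in> hom C X Y \<Longrightarrow> f \<cdot> Id C X = f"
    and comp_id_left: "f \<in> hom C X Y \<Longrightarrow> Id C Y \<cdot> f = f"
    and comp_assoc: "\<lbrakk>f \<in> hom C X Y; g \<in> hom C Y Z; h \<in> hom C Z V\<rbrakk> \<Longrightarrow>
      (h \<cdot> g) \<cdot> f = h \<cdot> (g \<cdot> f)"

definition isomorphism :: "('o, 'm, 'z) cat_scheme \<Rightarrow> 'm \<Rightarrow> bool" where
  "isomorphism C f \<longleftrightarrow> (\<exists>X Y. f \<in> hom C X Y \<and>
     (\<exists>g \<in> hom C Y X. g \<cdot>\<^bsub>C\<^esub> f = Id C X \<and> f \<cdot>\<^bsub>C\<^esub> g = Id C Y))"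

definition final_object :: "('o, 'm, 'z) cat_scheme \<Rightarrow> 'o \<Rightarrow> bool" where
  "final_object C t \<longleftrightarrow> t \<in> Obj C \<and> (\<forall>X \<in> Obj C. \<exists>!u. u \<in> hom C X t)"

definition initial_object :: "('o, 'm, 'z) cat_scheme \<Rightarrow> 'o \<Rightarrow> bool" where
  "initial_object C e \<longleftrightarrow> e \<in> Obj C \<and> (\<forall>X \<in> Obj C. \<exists>!u. u \<in> hom C e X)"

text \<open>The square \<open>f \<cdot> p = g \<cdot> q\<close> is a pullback of \<open>f\<close> and \<open>g\<close>; thus \<open>q\<close> is the base change of
  \<open>f\<close> along \<open>g\<close>, and \<open>p\<close> is the base change of \<open>g\<close> along \<open>f\<close>.\<close>

definition is_pullback :: "('o, 'm, 'z) cat_scheme \<Rightarrow> 'm \<Rightarrow> 'm \<Rightarrow> 'm \<Rightarrow> 'm \<Rightarrow> bool" where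
  "is_pullback C f g p q \<longleftrightarrow> (\<exists>A B D P.
     f \<in> hom C A D \<and> g \<in> hom C B D \<and> p \<in> hom C P A \<and> q \<in> hom C P B \<and>
     f \<cdot>\<^bsub>C\<^esub> p = g \<cdot>\<^bsub>C\<^esub> q \<and>
     (\<forall>T. \<forall>a \<in> hom C T A. \<forall>b \<in> hom C T B. f \<cdot>\<^bsub>C\<^esub> a = g \<cdot>\<^bsub>C\<^esub> b \<longrightarrow>
        (\<exists>!u. u \<in> hom C T P \<and> p \<cdot>\<^bsub>C\<^esub> u = a \<and> q \<cdot>\<^bsub>C\<^esub> u = b)))"

text \<open>The square \<open>p \<cdot> f = q \<cdot> g\<close> is a pushout of \<open>f\<close> and \<open>g\<close>.\<close>

definition is_pushout :: "('o, 'm, 'z) cat_scheme \<Rightarrow> 'm \<Rightarrow> 'm \<Rightarrow> 'm \<Rightarrow> 'm \<Rightarrow> bool" where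
  "is_pushout C f g p q \<longleftrightarrow> (\<exists>A B D P.
     f \<in> hom C D A \<and> g \<in> hom C D B \<and> p \<in> hom C A P \<and> q \<in> hom C B P \<and>
     p \<cdot>\<^bsub>C\<^esub> f = q \<cdot>\<^bsub>C\<^esub> g \<and>
     (\<forall>T. \<forall>a \<in> hom C A T. \<forall>b \<in> hom C B T. a \<cdot>\<^bsub>C\<^esub> f = b \<cdot>\<^bsub>C\<^esub> g \<longrightarrow>
        (\<exists>!u. u \<in> hom C P T \<and> u \<cdot>\<^bsub>C\<^esub> p = a \<and> u \<cdot>\<^bsub>C\<^esub> q = b)))"

definition is_product :: "('o, 'm, 'z) cat_scheme \<Rightarrow> 'o \<Rightarrow> 'o \<Rightarrow> 'o \<Rightarrow> 'm \<Rightarrow> 'm \<Rightarrow> bool" where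
  "is_product C A B P p1 p2 \<longleftrightarrow> p1 \<in> hom C P A \<and> p2 \<in> hom C P B \<and>
     (\<forall>T. \<forall>a \<in> hom C T A. \<forall>b \<in> hom C T B.
        \<exists>!u. u \<in> hom C T P \<and> p1 \<cdot>\<^bsub>C\<^esub> u = a \<and> p2 \<cdot>\<^bsub>C\<^esub> u = b)"

definition is_coproduct :: "('o, 'm, 'z) cat_scheme \<Rightarrow> 'o \<Rightarrow> 'o \<Rightarrow> 'o \<Rightarrow> 'm \<Rightarrow> 'm \<Rightarrow> bool" where
  "is_coproduct C A B S i1 i2 \<longleftrightarrow> i1 \<in> hom C A S \<and> i2 \<in> hom C B S \<and>
     (\<forall>T. \<forall>a \<in> hom C A T. \<forall>b \<in> hom C B T.
        \<exists>!u. u \<in> hom C S T \<and> u \<cdot>\<^bsub>C\<^esub> i1 = a \<and> u \<cdot>\<^bsub>C\<^esub> i2 = b)"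

text \<open>The morphism \<open>(f, g)\<close> into the product with projections \<open>p1\<close>, \<open>p2\<close>, respectively out of the
  coproduct with injections \<open>i1\<close>, \<open>i2\<close>. Meaningful only for (co)product diagrams.\<close>

definition pairing :: "('o, 'm, 'z) cat_scheme \<Rightarrow> 'm \<Rightarrow> 'm \<Rightarrow> 'm \<Rightarrow> 'm \<Rightarrow> 'm" where
  "pairing C p1 p2 f g = (THE u. u \<in> hom C (Dom C f) (Dom C p1) \<and>
     p1 \<cdot>\<^bsub>C\<^esub> u = f \<and> p2 \<cdot>\<^bsub>C\<^esub> u = g)"

definition copairing :: "('o, 'm, 'z) cat_scheme \<Rightarrow> 'm \<Rightarrow> 'm \<Rightarrow> 'm \<Rightarrow> 'm \<Rightarrow> 'm" where
  "copairing C i1 i2 f g = (THE u. u \<in> hom C (Cod C i1) (Cod C f) \<and>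
     u \<cdot>\<^bsub>C\<^esub> i1 = f \<and> u \<cdot>\<^bsub>C\<^esub> i2 = g)"

text \<open>Throughout, \<open>W\<close> is the class of weak equivalences, \<open>Fib\<close> that of fibrations and \<open>Cof\<close> that
  of cofibrations; trivial fibrations are the elements of \<open>W \<inter> Fib\<close>.\<close>

definition cofibrant ::
    "('o, 'm, 'z) cat_scheme \<Rightarrow> 'm set \<Rightarrow> 'm set \<Rightarrow> 'o \<Rightarrow> bool" where
  "cofibrant C W Fib Y \<longleftrightarrow> Y \<in> Obj C \<and>
     (\<forall>E. \<forall>p \<in> W \<inter> Fib \<inter> hom C E Y. \<exists>s \<in> hom C Y E. p \<cdot>\<^bsub>C\<^esub> s = Id C Y)"

text \<open>Isomorphisms being fibrations, it does not matter which final object is used here.\<close>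

definition star_fibrant :: "('o, 'm, 'z) cat_scheme \<Rightarrow> 'm set \<Rightarrow> 'o \<Rightarrow> bool" where
  "star_fibrant C Fib X \<longleftrightarrow> (\<exists>t. final_object C t \<and> (\<exists>u \<in> hom C X t. u \<in> Fib))"

locale fibration_category = category C
  for C :: "('o, 'm, 'z) cat_scheme" (structure) +
  fixes W Fib :: "'m set"
  assumes W_arr: "W \<subseteq> Arr C"
    and Fib_arr: "Fib \<subseteq> Arr C"
    and final_exists: "\<exists>t. final_object C t"
    and F1_iso: "isomorphism C f \<Longrightarrow> f \<in> W \<inter> Fib"
    and F1_comp: "\<lbrakk>f \<in> hom C X Y; g \<in> hom C Y Z; f \<in> Fib; g \<in> Fib\<rbrakk> \<Longrightarrow> g \<cdot> f \<in> Fib"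
    and F1_two_of_three_comp:
      "\<lbrakk>f \<in> hom C X Y; g \<in> hom C Y Z; f \<in> W; g \<in> W\<rbrakk> \<Longrightarrow> g \<cdot> f \<in> W"
    and F1_two_of_three_right:
      "\<lbrakk>f \<in> hom C X Y; g \<in> hom C Y Z; f \<in> W; g \<cdot> f \<in> W\<rbrakk> \<Longrightarrow> g \<in> W"
    and F1_two_of_three_left:
      "\<lbrakk>f \<in> hom C X Y; g \<in> hom C Y Z; g \<in> W; g \<cdot> f \<in> W\<rbrakk> \<Longrightarrow> f \<in> W"
    and F2_pullback: "\<lbrakk>f \<in> hom C A D; g \<in> hom C B D; f \<in> Fib\<rbrakk> \<Longrightarrow> \<exists>p q. is_pullback C f g p q"
    and F2_fib: "\<lbrakk>is_pullback C f g p q; f \<in> Fib\<rbrakk> \<Longrightarrow> q \<in> Fib"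
    and F2_trivial_fib: "\<lbrakk>is_pullback C f g p q; f \<in> W \<inter> Fib\<rbrakk> \<Longrightarrow> q \<in> W \<inter> Fib"
    and F2_weq: "\<lbrakk>is_pullback C f g p q; f \<in> Fib; g \<in> W\<rbrakk> \<Longrightarrow> p \<in> W"
    and F3: "f \<in> hom C X Y \<Longrightarrow>
      \<exists>Z. \<exists>w \<in> W \<inter> hom C X Z. \<exists>p \<in> Fib \<inter> hom C Z Y. f = p \<cdot> w"
    and F4: "X \<in> Obj C \<Longrightarrow> \<exists>Y. cofibrant C W Fib Y \<and> (\<exists>p. p \<in> W \<inter> Fib \<inter> hom C Y X)"

text \<open>Homotopy in a fibration category; \<open>S\<close> is the product \<open>Y \<times> Y\<close>, with projections \<open>p1\<close> and \<open>p2\<close>.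
  Only of interest for cofibrant \<open>X\<close> and \<open>*\<close>-fibrant \<open>Y\<close>.\<close>

definition fib_homotopic ::
    "('o, 'm, 'z) cat_scheme \<Rightarrow> 'm set \<Rightarrow> 'm set \<Rightarrow> 'm \<Rightarrow> 'm \<Rightarrow> bool" where
  "fib_homotopic C W Fib f g \<longleftrightarrow> (\<exists>X Y S p1 p2 P.
     f \<in> hom C X Y \<and> g \<in> hom C X Y \<and> is_product C Y Y S p1 p2 \<and>
     (\<exists>s \<in> W \<inter> hom C Y P. \<exists>q \<in> Fib \<inter> hom C P S.
        q \<cdot>\<^bsub>C\<^esub> s = pairing C p1 p2 (Id C Y) (Id C Y) \<and>
        (\<exists>h \<in> hom C X P. q \<cdot>\<^bsub>C\<^esub> h = pairing C p1 p2 f g)))"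

definition homotopy_equivalence ::
    "('o, 'm, 'z) cat_scheme \<Rightarrow> 'm set \<Rightarrow> 'm set \<Rightarrow> 'm \<Rightarrow> bool" where
  "homotopy_equivalence C W Fib f \<longleftrightarrow> (\<exists>X Y. f \<in> hom C X Y \<and>
     (\<exists>g \<in> hom C Y X. fib_homotopic C W Fib (g \<cdot>\<^bsub>C\<^esub> f) (Id C X) \<and>
        fib_homotopic C W Fib (f \<cdot>\<^bsub>C\<^esub> g) (Id C Y)))"

text \<open>Homotopy in a cofibration category; \<open>S\<close> is the coproduct of \<open>X\<close> with itself, with injections
  \<open>i1\<close> and \<open>i2\<close>.\<close>

definition cofib_homotopic ::
    "('o, 'm, 'z) cat_scheme \<Rightarrow> 'm set \<Rightarrow> 'm set \<Rightarrow> 'm \<Rightarrow> 'm \<Rightarrow> bool" where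
  "cofib_homotopic C W Cof f g \<longleftrightarrow> (\<exists>X Y S i1 i2 Z.
     f \<in> hom C X Y \<and> g \<in> hom C X Y \<and> is_coproduct C X X S i1 i2 \<and>
     (\<exists>j \<in> Cof \<inter> hom C S Z. \<exists>w \<in> W \<inter> hom C Z X.
        w \<cdot>\<^bsub>C\<^esub> j = copairing C i1 i2 (Id C X) (Id C X) \<and>
        (\<exists>h \<in> hom C Z Y. h \<cdot>\<^bsub>C\<^esub> j = copairing C i1 i2 f g)))"

definition left_lifting :: "('o, 'm, 'z) cat_scheme \<Rightarrow> 'm \<Rightarrow> 'm \<Rightarrow> bool" where
  "left_lifting C i p \<longleftrightarrow>
     (\<forall>u \<in> hom C (Dom C i) (Dom C p). \<forall>v \<in> hom C (Cod C i) (Cod C p).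
        p \<cdot>\<^bsub>C\<^esub> u = v \<cdot>\<^bsub>C\<^esub> i \<longrightarrow>
        (\<exists>l \<in> hom C (Cod C i) (Dom C p). l \<cdot>\<^bsub>C\<^esub> i = u \<and> p \<cdot>\<^bsub>C\<^esub> l = v))"

definition cofibrations :: "('o, 'm, 'z) cat_scheme \<Rightarrow> 'm set \<Rightarrow> 'm set \<Rightarrow> 'm set" where
  "cofibrations C W Fib = {i \<in> Arr C. \<forall>p \<in> W \<inter> Fib. left_lifting C i p}"

end

theory Submission
  imports Defs
begin

text \<open>A fibration category satisfies a weak lifting principle: a commutative square from a weak
  equivalence \<open>s\<close> with cofibrant target to a fibration admits a diagonal that makes the triangle
  over the fibration commute. Hence two maps into \<open>Y\<close> are homotopic as soon as they factor through the
  two legs of any \<open>b1, b2 : B \<rightarrow> Y\<close> with \<open>b1 s = b2 s\<close> for a weak equivalence \<open>s\<close> into \<open>B\<close>.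

  If \<open>h : Z \<rightarrow> Y\<close> is a homotopy on a cylinder \<open>w : Z \<rightarrow> X\<close>, let \<open>v\<close> be a homotopy inverse of \<open>w\<close>. The
  homotopy from \<open>v w\<close> to \<open>id\<close> joins both ends \<open>X \<rightarrow> Z\<close> of the cylinder to \<open>v\<close>, so it gives
  a map from \<open>X\<close> to the object of pairs of paths in \<open>Z\<close> with the same starting point, and the
  principle applies. Conversely, a homotopy into a path object \<open>P\<close> is turned into one on the cylinder
  by lifting against the trivial fibration \<open>P \<rightarrow> Y\<close>.\<close>

section \<open>Universal properties in the record encoding of categories\<close>

lemma pairing_props:
  assumes "is_product C A B S p1 p2" "a \<in> hom C T A" "b \<in> hom C T B"
  shows "pairing C p1 p2 a b \<in> hom C T S"
    and "p1 \<cdot>\<^bsub>C\<^esub> pairing C p1 p2 a b = a" and "p2 \<cdot>\<^bsub>C\<^esub> pairing C p1 p2 a b = b"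
proof -
  have ex: "\<exists>!u. u \<in> hom C T S \<and> p1 \<cdot>\<^bsub>C\<^esub> u = a \<and> p2 \<cdot>\<^bsub>C\<^esub> u = b"
    using assms unfolding is_product_def by blast
  \<comment> \<open>\<open>pairing\<close> reads its source and target off \<open>Dom C a\<close>
    and \<open>Dom C p1\<close>. Only after these are identified with \<open>T\<close> and
    \<open>S\<close> does its description match the unique existence of the product.\<close>
  have "Dom C a = T" "Dom C p1 = S"
    using assms unfolding is_product_def hom_def by auto
  then have "pairing C p1 p2 a b = (THE u. u \<in> hom C T S \<and> p1 \<cdot>\<^bsub>C\<^esub> u = a \<and> p2 \<cdot>\<^bsub>C\<^esub> u = b)"
    by (simp add: pairing_def)
  note theI'[OF ex, folded this]
  then show "pairing C p1 p2 a b \<in> hom C T S"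
    and "p1 \<cdot>\<^bsub>C\<^esub> pairing C p1 p2 a b = a" and "p2 \<cdot>\<^bsub>C\<^esub> pairing C p1 p2 a b = b"
    by auto
qed

lemma copairing_props:
  assumes "is_coproduct C A B S i1 i2" "a \<in> hom C A T" "b \<in> hom C B T"
  shows "copairing C i1 i2 a b \<in> hom C S T"
    and "copairing C i1 i2 a b \<cdot>\<^bsub>C\<^esub> i1 = a" and "copairing C i1 i2 a b \<cdot>\<^bsub>C\<^esub> i2 = b"
proof -
  have ex: "\<exists>!u. u \<in> hom C S T \<and> u \<cdot>\<^bsub>C\<^esub> i1 = a \<and> u \<cdot>\<^bsub>C\<^esub> i2 = b"
    using assms unfolding is_coproduct_def by blast
  have "Cod C a = T" "Cod C i1 = S"
    using assms unfolding is_coproduct_def hom_def by auto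
  then have "copairing C i1 i2 a b = (THE u. u \<in> hom C S T \<and> u \<cdot>\<^bsub>C\<^esub> i1 = a \<and> u \<cdot>\<^bsub>C\<^esub> i2 = b)"
    by (simp add: copairing_def)
  note theI'[OF ex, folded this]
  then show "copairing C i1 i2 a b \<in> hom C S T"
    and "copairing C i1 i2 a b \<cdot>\<^bsub>C\<^esub> i1 = a" and "copairing C i1 i2 a b \<cdot>\<^bsub>C\<^esub> i2 = b"
    by auto
qed

text \<open>\<open>is_pullback\<close> hides its objects behind existential quantifiers. Since
  \<open>Dom\<close> and \<open>Cod\<close> are functions, known ends of \<open>f\<close> and
  \<open>g\<close> fix all of them except the apex, so the universal property can be used with
  prescribed objects.\<close>

lemma pullback_cone:
  assumes "is_pullback C f g p q" "f \<in> hom C A D" "g \<in> hom C B D"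
  obtains P where "p \<in> hom C P A" "q \<in> hom C P B" "f \<cdot>\<^bsub>C\<^esub> p = g \<cdot>\<^bsub>C\<^esub> q"
    "\<forall>T. \<forall>a \<in> hom C T A. \<forall>b \<in> hom C T B. f \<cdot>\<^bsub>C\<^esub> a = g \<cdot>\<^bsub>C\<^esub> b \<longrightarrow>
       (\<exists>!u. u \<in> hom C T P \<and> p \<cdot>\<^bsub>C\<^esub> u = a \<and> q \<cdot>\<^bsub>C\<^esub> u = b)"
proof -
  obtain A' B' D' P where *: "f \<in> hom C A' D'" "g \<in> hom C B' D'" "p \<in> hom C P A'"
      "q \<in> hom C P B'" "f \<cdot>\<^bsub>C\<^esub> p = g \<cdot>\<^bsub>C\<^esub> q"
      "\<forall>T. \<forall>a \<in> hom C T A'. \<forall>b \<in> hom C T B'. f \<cdot>\<^bsub>C\<^esub> a = g \<cdot>\<^bsub>C\<^esub> b \<longrightarrow>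
        (\<exists>!u. u \<in> hom C T P \<and> p \<cdot>\<^bsub>C\<^esub> u = a \<and> q \<cdot>\<^bsub>C\<^esub> u = b)"
    using assms(1) unfolding is_pullback_def by blast
  have "A' = A" "B' = B"
    using * assms unfolding hom_def by auto
  with * show ?thesis
    by (intro that[of P]) auto
qed

lemma pushout_cocone:
  assumes "is_pushout C f g p q" "f \<in> hom C D A" "g \<in> hom C D B"
  obtains P where "p \<in> hom C A P" "q \<in> hom C B P" "p \<cdot>\<^bsub>C\<^esub> f = q \<cdot>\<^bsub>C\<^esub> g"
    "\<forall>T. \<forall>a \<in> hom C A T. \<forall>b \<in> hom C B T. a \<cdot>\<^bsub>C\<^esub> f = b \<cdot>\<^bsub>C\<^esub> g \<longrightarrow>
       (\<exists>!u. u \<in> hom C P T \<and> u \<cdot>\<^bsub>C\<^esub> p = a \<and> u \<cdot>\<^bsub>C\<^esub> q = b)"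
proof -
  obtain A' B' D' P where *: "f \<in> hom C D' A'" "g \<in> hom C D' B'" "p \<in> hom C A' P"
      "q \<in> hom C B' P" "p \<cdot>\<^bsub>C\<^esub> f = q \<cdot>\<^bsub>C\<^esub> g"
      "\<forall>T. \<forall>a \<in> hom C A' T. \<forall>b \<in> hom C B' T. a \<cdot>\<^bsub>C\<^esub> f = b \<cdot>\<^bsub>C\<^esub> g \<longrightarrow>
        (\<exists>!u. u \<in> hom C P T \<and> u \<cdot>\<^bsub>C\<^esub> p = a \<and> u \<cdot>\<^bsub>C\<^esub> q = b)"
    using assms(1) unfolding is_pushout_def by blast
  have "A' = A" "B' = B"
    using * assms unfolding hom_def by auto
  with * show ?thesis
    by (intro that[of P]) auto
qed

context category
begin

lemma hom_objs:
  assumes "f \<in> hom C X Y"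
  shows "X \<in> Obj C" "Y \<in> Obj C"
  using assms dom_obj cod_obj unfolding hom_def by auto

lemma product_unique:
  assumes S: "is_product C A B S p1 p2" and u: "u \<in> hom C T S" and v: "v \<in> hom C T S"
    and "p1 \<cdot> u = p1 \<cdot> v" "p2 \<cdot> u = p2 \<cdot> v"
  shows "u = v"
proof -
  have "p1 \<cdot> v \<in> hom C T A" "p2 \<cdot> v \<in> hom C T B"
    using S comp_hom[OF v] unfolding is_product_def by auto
  then have "\<exists>!x. x \<in> hom C T S \<and> p1 \<cdot> x = p1 \<cdot> v \<and> p2 \<cdot> x = p2 \<cdot> v"
    using S unfolding is_product_def by blast
  then show ?thesis
    using assms by blast
qed

lemma coproduct_unique:
  assumes S: "is_coproduct C A B S i1 i2" and u: "u \<in> hom C S T" and v: "v \<in> hom C S T"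
    and "u \<cdot> i1 = v \<cdot> i1" "u \<cdot> i2 = v \<cdot> i2"
  shows "u = v"
proof -
  have "v \<cdot> i1 \<in> hom C A T" "v \<cdot> i2 \<in> hom C B T"
    using S comp_hom[OF _ v] unfolding is_coproduct_def by auto
  then have "\<exists>!x. x \<in> hom C S T \<and> x \<cdot> i1 = v \<cdot> i1 \<and> x \<cdot> i2 = v \<cdot> i2"
    using S unfolding is_coproduct_def by blast
  then show ?thesis
    using assms by blast
qed

text \<open>Over a final object every square commutes. This makes the projections of a product base
  changes of maps to the final object, so stability of fibrations applies to them.\<close>

lemma product_is_pullback:
  assumes t: "final_object C t" and u: "u \<in> hom C A t" and v: "v \<in> hom C B t"
    and S: "is_product C A B S p1 p2"
  shows "is_pullback C u v p1 p2"
proof -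
  have p: "p1 \<in> hom C S A" "p2 \<in> hom C S B"
    using S unfolding is_product_def by auto
  have "u \<cdot> p1 = v \<cdot> p2"
    using t hom_objs[OF p(1)] comp_hom[OF p(1) u] comp_hom[OF p(2) v]
    unfolding final_object_def by blast
  then show ?thesis
    using S p u v unfolding is_product_def is_pullback_def
    by (intro exI[of _ A] exI[of _ B] exI[of _ t] exI[of _ S]) simp
qed

lemma pullback_is_product:
  assumes t: "final_object C t" and u: "u \<in> hom C A t" and v: "v \<in> hom C B t"
    and pb: "is_pullback C u v p1 p2"
  shows "\<exists>S. is_product C A B S p1 p2"
proof -
  obtain S where p: "p1 \<in> hom C S A" "p2 \<in> hom C S B"
    and univ[rule_format]: "\<forall>T. \<forall>a \<in> hom C T A. \<forall>b \<in> hom C T B. u \<cdot> a = v \<cdot> b \<longrightarrow>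
       (\<exists>!x. x \<in> hom C T S \<and> p1 \<cdot> x = a \<and> p2 \<cdot> x = b)"
    by (rule pullback_cone[OF pb u v]) (rule that)
  have "u \<cdot> a = v \<cdot> b" if "a \<in> hom C T A" "b \<in> hom C T B" for T a b
    using t hom_objs[OF that(1)] comp_hom[OF that(1) u] comp_hom[OF that(2) v]
    unfolding final_object_def by blast
  with p univ have "is_product C A B S p1 p2"
    unfolding is_product_def by blast
  then show ?thesis ..
qed

text \<open>Under an initial object every square commutes, so the condition on cocones is vacuous.
  This is how coproducts are extracted from the pushout hypothesis.\<close>

lemma pushout_is_coproduct:
  assumes e: "initial_object C e" and u: "u \<in> hom C e A" and v: "v \<in> hom C e B"
    and po: "is_pushout C u v i1 i2"
  shows "\<exists>S. is_coproduct C A B S i1 i2"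
proof -
  obtain S where i: "i1 \<in> hom C A S" "i2 \<in> hom C B S"
    and univ[rule_format]: "\<forall>T. \<forall>a \<in> hom C A T. \<forall>b \<in> hom C B T. a \<cdot> u = b \<cdot> v \<longrightarrow>
       (\<exists>!x. x \<in> hom C S T \<and> x \<cdot> i1 = a \<and> x \<cdot> i2 = b)"
    by (rule pushout_cocone[OF po u v]) (rule that)
  have "a \<cdot> u = b \<cdot> v" if "a \<in> hom C A T" "b \<in> hom C B T" for T a b
    using e hom_objs[OF that(1)] comp_hom[OF u that(1)] comp_hom[OF v that(2)]
    unfolding initial_object_def by blast
  with i univ have "is_coproduct C A B S i1 i2"
    unfolding is_coproduct_def by blast
  then show ?thesis ..
qed

end

section \<open>Lifting and homotopies in a fibration category\<close>

context fibration_category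
begin

text \<open>A diagonal over \<open>b\<close> amounts to a section of the base change
  \<open>r\<close> of \<open>q\<close> along \<open>b\<close>. The square turns \<open>s\<close>
  into a map \<open>k\<close> to the pullback with \<open>r k = s\<close>, and this provides the
  section.\<close>

lemma weak_lifting:
  assumes B: "cofibrant C W Fib B" and s: "s \<in> hom C A B" "s \<in> W"
    and q: "q \<in> hom C E D" "q \<in> Fib" and a: "a \<in> hom C A E" and b: "b \<in> hom C B D"
    and sq: "q \<cdot> a = b \<cdot> s"
  shows "\<exists>l \<in> hom C B E. q \<cdot> l = b"
proof -
  obtain e r where pb: "is_pullback C q b e r"
    using F2_pullback[OF q(1) b q(2)] by blast
  obtain K where e: "e \<in> hom C K E" and r: "r \<in> hom C K B" and er: "q \<cdot> e = b \<cdot> r"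
    and univ[rule_format]: "\<forall>T. \<forall>x \<in> hom C T E. \<forall>y \<in> hom C T B. q \<cdot> x = b \<cdot> y \<longrightarrow>
       (\<exists>!u. u \<in> hom C T K \<and> e \<cdot> u = x \<and> r \<cdot> u = y)"
    by (rule pullback_cone[OF pb q(1) b]) (rule that)
  obtain k where k: "k \<in> hom C A K" "r \<cdot> k = s"
    using univ[OF a s(1) sq] by blast
  \<comment> \<open>The fibration \<open>r\<close> need not be a weak equivalence, so cofibrancy of
    \<open>B\<close> gives it no section directly. After factoring \<open>k\<close>, the fibration
    \<open>r n\<close> satisfies \<open>r n m = s\<close> and is trivial by two-out-of-three. If
    \<open>t\<close> is a section of it, then \<open>n t\<close> is a section of
    \<open>r\<close>.\<close>
  obtain L m n where m: "m \<in> W" "m \<in> hom C A L" and n: "n \<in> Fib" "n \<in> hom C L K"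
    and kmn: "k = n \<cdot> m"
    using F3[OF k(1)] by blast
  have "r \<cdot> n \<in> Fib"
    using F1_comp[OF n(2) r n(1)] F2_fib[OF pb q(2)] by blast
  moreover have rn: "r \<cdot> n \<in> hom C L B"
    using comp_hom[OF n(2) r] .
  moreover have "(r \<cdot> n) \<cdot> m = s"
    using comp_assoc[OF m(2) n(2) r] k kmn by simp
  then have "r \<cdot> n \<in> W"
    using F1_two_of_three_right[OF m(2) rn m(1)] s(2) by simp
  ultimately obtain t where t: "t \<in> hom C B L" "(r \<cdot> n) \<cdot> t = Id C B"
    using B unfolding cofibrant_def by blast
  have nt: "n \<cdot> t \<in> hom C B K"
    using comp_hom[OF t(1) n(2)] .
  have "q \<cdot> (e \<cdot> (n \<cdot> t)) = (q \<cdot> e) \<cdot> (n \<cdot> t)"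
    using comp_assoc[OF nt e q(1)] by simp
  also have "\<dots> = b \<cdot> (r \<cdot> (n \<cdot> t))"
    using comp_assoc[OF nt r b] er by simp
  also have "r \<cdot> (n \<cdot> t) = Id C B"
    using comp_assoc[OF t(1) n(2) r] t(2) by simp
  finally have "q \<cdot> (e \<cdot> (n \<cdot> t)) = b"
    using comp_id_right[OF b] by simp
  then show ?thesis
    using comp_hom[OF nt e] by blast
qed

text \<open>The base change of a trivial fibration along \<open>v\<close> is a trivial fibration
  over the cofibrant object \<open>B\<close>, and a section of it yields the lift. The triangle
  under \<open>e\<close> commutes because maps out of \<open>e\<close> are unique. With this the
  pushout hypothesis applies to \<open>e\<close> over any object.\<close>

lemma initial_cofibration:
  assumes e: "initial_object C e" and B: "cofibrant C W Fib B" and i: "i \<in> hom C e B"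
  shows "i \<in> cofibrations C W Fib"
proof -
  have "left_lifting C i p" if p: "p \<in> W" "p \<in> Fib" for p
    unfolding left_lifting_def
  proof (intro ballI impI)
    have ends: "Dom C i = e" "Cod C i = B"
      using i unfolding hom_def by auto
    fix u v
    assume "u \<in> hom C (Dom C i) (Dom C p)" "v \<in> hom C (Cod C i) (Cod C p)"
    then have u: "u \<in> hom C e (Dom C p)" and v: "v \<in> hom C B (Cod C p)"
      using ends by auto
    have ph: "p \<in> hom C (Dom C p) (Cod C p)"
      using p W_arr unfolding hom_def by auto
    obtain q r where pb: "is_pullback C p v q r"
      using F2_pullback[OF ph v p(2)] by blast
    obtain K where q: "q \<in> hom C K (Dom C p)" and r: "r \<in> hom C K B" and qr: "p \<cdot> q = v \<cdot> r"
      by (rule pullback_cone[OF pb ph v]) (rule that)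
    obtain t where t: "t \<in> hom C B K" "r \<cdot> t = Id C B"
      using B F2_trivial_fib[OF pb] p r unfolding cofibrant_def by blast
    have l: "q \<cdot> t \<in> hom C B (Dom C p)"
      using comp_hom[OF t(1) q] .
    have "p \<cdot> (q \<cdot> t) = v"
      using comp_assoc[OF t(1) q ph] comp_assoc[OF t(1) r v] comp_id_right[OF v] qr t(2) by simp
    moreover have "(q \<cdot> t) \<cdot> i = u"
      using e u comp_hom[OF i l] hom_objs[OF u] unfolding initial_object_def by blast
    ultimately show "\<exists>l \<in> hom C (Cod C i) (Dom C p). l \<cdot> i = u \<and> p \<cdot> l = v"
      using l ends by auto
  qed
  then show ?thesis
    using i unfolding cofibrations_def hom_def by auto
qed

lemma star_fibrant_product:
  assumes "star_fibrant C Fib Y"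
  shows "\<exists>S p1 p2. is_product C Y Y S p1 p2"
proof -
  obtain t u where t: "final_object C t" and u: "u \<in> hom C Y t" "u \<in> Fib"
    using assms unfolding star_fibrant_def by blast
  then show ?thesis
    using F2_pullback[OF u(1) u(1) u(2)] pullback_is_product[OF t u(1) u(1)] by blast
qed

text \<open>The projection \<open>p1\<close> is a base change of the fibration from \<open>Y\<close>
  to the final object, so \<open>p1 q\<close> is a fibration. It is a weak equivalence by
  two-out-of-three, having the weak equivalence \<open>s\<close> as a section.\<close>

lemma path_object_projection:
  assumes Y: "star_fibrant C Fib Y" and S: "is_product C Y Y S p1 p2"
    and s: "s \<in> hom C Y P" "s \<in> W" and q: "q \<in> hom C P S" "q \<in> Fib"
    and qs: "q \<cdot> s = pairing C p1 p2 (Id C Y) (Id C Y)"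
  shows "p1 \<cdot> q \<in> hom C P Y" "p1 \<cdot> q \<in> W \<inter> Fib" "(p1 \<cdot> q) \<cdot> s = Id C Y"
    "p2 \<cdot> q \<in> hom C P Y" "(p2 \<cdot> q) \<cdot> s = Id C Y"
proof -
  have p: "p1 \<in> hom C S Y" "p2 \<in> hom C S Y"
    using S unfolding is_product_def by auto
  have Yid: "Id C Y \<in> hom C Y Y"
    using id_hom hom_objs[OF s(1)] by blast
  show pq: "p1 \<cdot> q \<in> hom C P Y" and "p2 \<cdot> q \<in> hom C P Y"
    using comp_hom[OF q(1)] p by auto
  show pqs: "(p1 \<cdot> q) \<cdot> s = Id C Y"
    using comp_assoc[OF s(1) q(1) p(1)] pairing_props(2)[OF S Yid Yid] qs by simp
  show "(p2 \<cdot> q) \<cdot> s = Id C Y"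
    using comp_assoc[OF s(1) q(1) p(2)] pairing_props(3)[OF S Yid Yid] qs by simp
  obtain t u where t: "final_object C t" and u: "u \<in> hom C Y t" "u \<in> Fib"
    using Y unfolding star_fibrant_def by blast
  \<comment> \<open>The projections are swapped because \<open>F2_fib\<close> concerns the last leg
    of the pullback.\<close>
  have "is_product C Y Y S p2 p1"
    using S unfolding is_product_def by metis
  then have "is_pullback C u u p2 p1"
    using product_is_pullback[OF t u(1) u(1)] by blast
  then have "p1 \<in> Fib"
    using F2_fib u(2) by blast
  moreover have "isomorphism C (Id C Y)"
    using Yid comp_id_left[OF Yid] unfolding isomorphism_def by blast
  then have "Id C Y \<in> W"
    using F1_iso by blast
  then have "p1 \<cdot> q \<in> W"
    using F1_two_of_three_right[OF s(1) pq s(2)] pqs by simp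
  ultimately show "p1 \<cdot> q \<in> W \<inter> Fib"
    using F1_comp[OF q(1) p(1) q(2)] by blast
qed

text \<open>Along \<open>s\<close> the maps \<open>b1\<close> and \<open>b2\<close> coincide, so
  there the constant homotopy joins them. Weak lifting carries a homotopy over to all of
  \<open>B\<close>, and precomposing with \<open>t\<close> finishes.\<close>

lemma fib_homotopicI:
  assumes Y: "star_fibrant C Fib Y" and B: "cofibrant C W Fib B"
    and s: "s \<in> hom C A B" "s \<in> W" and b: "b1 \<in> hom C B Y" "b2 \<in> hom C B Y"
    and bs: "b1 \<cdot> s = b2 \<cdot> s" and t: "t \<in> hom C X B"
  shows "fib_homotopic C W Fib (b1 \<cdot> t) (b2 \<cdot> t)"
proof -
  obtain S p1 p2 where S: "is_product C Y Y S p1 p2"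
    using star_fibrant_product[OF Y] by blast
  have p: "p1 \<in> hom C S Y" "p2 \<in> hom C S Y"
    using S unfolding is_product_def by auto
  have Yid: "Id C Y \<in> hom C Y Y"
    using id_hom hom_objs[OF b(1)] by blast
  note diag = pairing_props[OF S Yid Yid]
  obtain P c q where c: "c \<in> W" "c \<in> hom C Y P" and q: "q \<in> Fib" "q \<in> hom C P S"
    and qc: "pairing C p1 p2 (Id C Y) (Id C Y) = q \<cdot> c"
    using F3[OF diag(1)] by blast
  note bb = pairing_props[OF S b]
  have b1s: "b1 \<cdot> s \<in> hom C A Y"
    using comp_hom[OF s(1) b(1)] .
  \<comment> \<open>The constant homotopy at \<open>b1 s = b2 s\<close>: its image under
    \<open>q\<close> is the diagonal after \<open>b1 s\<close>, which is the pair
    \<open>(b1, b2)\<close> restricted along \<open>s\<close>.\<close>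
  have cb: "c \<cdot> (b1 \<cdot> s) \<in> hom C A P"
    using comp_hom[OF b1s c(2)] .
  have qcb: "q \<cdot> (c \<cdot> (b1 \<cdot> s)) = pairing C p1 p2 (Id C Y) (Id C Y) \<cdot> (b1 \<cdot> s)"
    using comp_assoc[OF b1s c(2) q(2)] qc by simp
  have "q \<cdot> (c \<cdot> (b1 \<cdot> s)) = pairing C p1 p2 b1 b2 \<cdot> s"
  proof (rule product_unique[OF S comp_hom[OF cb q(2)] comp_hom[OF s(1) bb(1)]])
    show "p1 \<cdot> (q \<cdot> (c \<cdot> (b1 \<cdot> s))) = p1 \<cdot> (pairing C p1 p2 b1 b2 \<cdot> s)"
      unfolding qcb using comp_assoc[OF b1s diag(1) p(1)] comp_assoc[OF s(1) bb(1) p(1)]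
        diag bb comp_id_left[OF b1s] by simp
    show "p2 \<cdot> (q \<cdot> (c \<cdot> (b1 \<cdot> s))) = p2 \<cdot> (pairing C p1 p2 b1 b2 \<cdot> s)"
      unfolding qcb using comp_assoc[OF b1s diag(1) p(2)] comp_assoc[OF s(1) bb(1) p(2)]
        diag bb comp_id_left[OF b1s] bs by simp
  qed
  then obtain l where l: "l \<in> hom C B P" "q \<cdot> l = pairing C p1 p2 b1 b2"
    using weak_lifting[OF B s q(2,1) cb bb(1)] by blast
  have bt: "b1 \<cdot> t \<in> hom C X Y" "b2 \<cdot> t \<in> hom C X Y"
    using comp_hom[OF t] b by auto
  have lt: "l \<cdot> t \<in> hom C X P"
    using comp_hom[OF t l(1)] .
  note bbt = pairing_props[OF S bt]
  have "q \<cdot> (l \<cdot> t) = pairing C p1 p2 (b1 \<cdot> t) (b2 \<cdot> t)"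
  proof (rule product_unique[OF S comp_hom[OF lt q(2)] bbt(1)])
    have eq: "q \<cdot> (l \<cdot> t) = pairing C p1 p2 b1 b2 \<cdot> t"
      using comp_assoc[OF t l(1) q(2)] l(2) by simp
    show "p1 \<cdot> (q \<cdot> (l \<cdot> t)) = p1 \<cdot> pairing C p1 p2 (b1 \<cdot> t) (b2 \<cdot> t)"
      unfolding eq bbt using comp_assoc[OF t bb(1) p(1)] bb by simp
    show "p2 \<cdot> (q \<cdot> (l \<cdot> t)) = p2 \<cdot> pairing C p1 p2 (b1 \<cdot> t) (b2 \<cdot> t)"
      unfolding eq bbt using comp_assoc[OF t bb(1) p(2)] bb by simp
  qed
  then show ?thesis
    unfolding fib_homotopic_def using bt S c q qc[symmetric] lt by blast
qed

text \<open>The two maps are joined through \<open>v w k1 = v w k2\<close>, so neither symmetry nor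
  transitivity of the homotopy relation is needed.\<close>

lemma homotopic_of_weak_left_inverse:
  assumes cof: "\<And>A. A \<in> Obj C \<Longrightarrow> cofibrant C W Fib A"
    and fib: "\<And>A. A \<in> Obj C \<Longrightarrow> star_fibrant C Fib A"
    and w: "w \<in> hom C Z X" and v: "v \<in> hom C X Z"
    and vw: "fib_homotopic C W Fib (v \<cdot> w) (Id C Z)"
    and k: "k1 \<in> hom C T Z" "k2 \<in> hom C T Z" "w \<cdot> k1 = w \<cdot> k2" and h: "h \<in> hom C Z Y"
  shows "fib_homotopic C W Fib (h \<cdot> k1) (h \<cdot> k2)"
proof -
  obtain X' Z' S p1 p2 P s q H where
    ends: "v \<cdot> w \<in> hom C X' Z'" and S': "is_product C Z' Z' S p1 p2"
    and s': "s \<in> W" "s \<in> hom C Z' P" and q: "q \<in> Fib" "q \<in> hom C P S"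
    and qs': "q \<cdot> s = pairing C p1 p2 (Id C Z') (Id C Z')"
    and H': "H \<in> hom C X' P" and qH: "q \<cdot> H = pairing C p1 p2 (v \<cdot> w) (Id C Z)"
    using vw unfolding fib_homotopic_def by blast
  have vwZ: "v \<cdot> w \<in> hom C Z Z"
    using comp_hom[OF w v] .
  have "X' = Z" "Z' = Z"
    using ends vwZ unfolding hom_def by auto
  note S = S'[unfolded \<open>Z' = Z\<close>] and s = s'[unfolded \<open>Z' = Z\<close>] and H = H'[unfolded \<open>X' = Z\<close>]
    and qs = qs'[unfolded \<open>Z' = Z\<close>]
  have Z: "Z \<in> Obj C"
    using hom_objs[OF w] by blast
  have p: "p1 \<in> hom C S Z" "p2 \<in> hom C S Z"
    using S unfolding is_product_def by auto
  \<comment> \<open>The start and end of a path in \<open>P\<close>. The homotopy \<open>H\<close>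
    starts at \<open>v w\<close> and ends at the identity.\<close>
  define d0 where "d0 = p1 \<cdot> q"
  define d1 where "d1 = p2 \<cdot> q"
  note proj = path_object_projection[OF fib[OF Z] S s(2,1) q(2,1) qs, folded d0_def d1_def]
  have d0: "d0 \<in> hom C P Z" "d0 \<in> W" "d0 \<in> Fib" "d0 \<cdot> s = Id C Z"
    and d1: "d1 \<in> hom C P Z" "d1 \<cdot> s = Id C Z"
    using proj by auto
  note vwid = pairing_props[OF S vwZ id_hom[OF Z]]
  have d0H: "d0 \<cdot> H = v \<cdot> w" and d1H: "d1 \<cdot> H = Id C Z"
    unfolding d0_def d1_def
    using comp_assoc[OF H q(2) p(1)] comp_assoc[OF H q(2) p(2)] qH vwid by simp_all
  \<comment> \<open>The apex \<open>B\<close> of this pullback consists of pairs of paths in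
    \<open>Z\<close> with a common start; \<open>a\<close> and \<open>b\<close> are its two
    components.\<close>
  obtain a b where pb: "is_pullback C d0 d0 a b"
    using F2_pullback[OF d0(1) d0(1) d0(3)] by blast
  obtain B where a: "a \<in> hom C B P" and b: "b \<in> hom C B P"
    and univ[rule_format]: "\<forall>T. \<forall>x \<in> hom C T P. \<forall>y \<in> hom C T P. d0 \<cdot> x = d0 \<cdot> y \<longrightarrow>
       (\<exists>!u. u \<in> hom C T B \<and> a \<cdot> u = x \<and> b \<cdot> u = y)"
    by (rule pullback_cone[OF pb d0(1) d0(1)]) (rule that)
  \<comment> \<open>Pairs of constant paths. As a base change of the trivial fibration
    \<open>d0\<close>, \<open>b\<close> is a weak equivalence, hence so is \<open>c\<close> by
    \<open>b c = s\<close>.\<close>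
  obtain c where c: "c \<in> hom C Z B" "a \<cdot> c = s" "b \<cdot> c = s"
    using univ[OF s(2) s(2)] by blast
  have "b \<in> W"
    using F2_trivial_fib[OF pb] d0 by blast
  then have cW: "c \<in> W"
    using F1_two_of_three_left[OF c(1) b] c(3) s(1) by simp
  have Hk: "H \<cdot> k1 \<in> hom C T P" "H \<cdot> k2 \<in> hom C T P"
    using comp_hom[OF _ H] k by auto
  \<comment> \<open>The paths \<open>H k1\<close> and \<open>H k2\<close> start at
    \<open>v w k1\<close> and \<open>v w k2\<close>, which agree, so they form a map
    \<open>t\<close> into \<open>B\<close>.\<close>
  have d0Hk: "d0 \<cdot> (H \<cdot> k1) = v \<cdot> (w \<cdot> k1)" "d0 \<cdot> (H \<cdot> k2) = v \<cdot> (w \<cdot> k2)"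
    using comp_assoc[OF k(1) H d0(1)] comp_assoc[OF k(2) H d0(1)] d0H
      comp_assoc[OF k(1) w v] comp_assoc[OF k(2) w v] by simp_all
  then obtain t where t: "t \<in> hom C T B" "a \<cdot> t = H \<cdot> k1" "b \<cdot> t = H \<cdot> k2"
    using univ[OF Hk] k(3) by auto
  have hd: "h \<cdot> d1 \<in> hom C P Y"
    using comp_hom[OF d1(1) h] .
  have hda: "(h \<cdot> d1) \<cdot> a \<in> hom C B Y" "(h \<cdot> d1) \<cdot> b \<in> hom C B Y"
    using comp_hom[OF _ hd] a b by auto
  \<comment> \<open>The two end maps followed by \<open>h\<close> play the roles of
    \<open>b1\<close> and \<open>b2\<close> in \<open>fib_homotopicI\<close>; on constant paths both
    are \<open>h d1 s\<close>.\<close>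
  have "((h \<cdot> d1) \<cdot> a) \<cdot> c = ((h \<cdot> d1) \<cdot> b) \<cdot> c"
    using comp_assoc[OF c(1) a hd] comp_assoc[OF c(1) b hd] c by simp
  then have "fib_homotopic C W Fib (((h \<cdot> d1) \<cdot> a) \<cdot> t) (((h \<cdot> d1) \<cdot> b) \<cdot> t)"
    using fib_homotopicI[OF fib cof c(1) cW hda _ t(1)] hom_objs[OF h] hom_objs[OF a] by blast
  \<comment> \<open>Since \<open>H\<close> ends at the identity, the ends of the paths in
    \<open>t\<close> are \<open>k1\<close> and \<open>k2\<close>.\<close>
  moreover have "(h \<cdot> d1) \<cdot> (H \<cdot> k) = h \<cdot> k" if k: "k \<in> hom C T Z" for k
    using comp_assoc[OF comp_hom[OF k H] d1(1) h] comp_assoc[OF k H d1(1)] d1H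
      comp_id_left[OF k] by simp
  then have "((h \<cdot> d1) \<cdot> a) \<cdot> t = h \<cdot> k1" "((h \<cdot> d1) \<cdot> b) \<cdot> t = h \<cdot> k2"
    using comp_assoc[OF t(1) a hd] comp_assoc[OF t(1) b hd] t k by simp_all
  ultimately show ?thesis
    by simp
qed

section \<open>Comparison of the two homotopy relations\<close>

lemma cofib_homotopic_imp_fib_homotopic:
  assumes cof: "\<And>A. A \<in> Obj C \<Longrightarrow> cofibrant C W Fib A"
    and fib: "\<And>A. A \<in> Obj C \<Longrightarrow> star_fibrant C Fib A"
    and he: "\<And>a. a \<in> W \<Longrightarrow> homotopy_equivalence C W Fib a"
    and fg: "cofib_homotopic C W Cof f g"
  shows "fib_homotopic C W Fib f g"
proof -
  obtain X Y S i1 i2 Z j w h where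
    f: "f \<in> hom C X Y" and g: "g \<in> hom C X Y" and S: "is_coproduct C X X S i1 i2"
    and j: "j \<in> hom C S Z" and w: "w \<in> W" "w \<in> hom C Z X"
    and wj: "w \<cdot> j = copairing C i1 i2 (Id C X) (Id C X)"
    and h: "h \<in> hom C Z Y" and hj: "h \<cdot> j = copairing C i1 i2 f g"
    using fg unfolding cofib_homotopic_def by blast
  have Xid: "Id C X \<in> hom C X X"
    using id_hom hom_objs[OF f] by blast
  have i: "i1 \<in> hom C X S" "i2 \<in> hom C X S"
    using S unfolding is_coproduct_def by auto
  \<comment> \<open>Both ends of the cylinder are sections of \<open>w\<close>; they serve as
    \<open>k1\<close> and \<open>k2\<close>.\<close>
  have "w \<cdot> (j \<cdot> i1) = w \<cdot> (j \<cdot> i2)"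
    using comp_assoc[OF i(1) j w(2)] comp_assoc[OF i(2) j w(2)] wj
      copairing_props[OF S Xid Xid] by simp
  moreover obtain X' Z' v where w': "w \<in> hom C Z' X'" and v: "v \<in> hom C X' Z'"
    and vw: "fib_homotopic C W Fib (v \<cdot> w) (Id C Z')"
    using he[OF w(1)] unfolding homotopy_equivalence_def by blast
  have "X' = X" "Z' = Z"
    using w w' unfolding hom_def by auto
  note v = v[unfolded this] and vw = vw[unfolded this]
  ultimately have "fib_homotopic C W Fib (h \<cdot> (j \<cdot> i1)) (h \<cdot> (j \<cdot> i2))"
    using homotopic_of_weak_left_inverse[OF cof fib w(2) v vw comp_hom[OF i(1) j]
        comp_hom[OF i(2) j] _ h] by blast
  then show ?thesis
    using comp_assoc[OF i(1) j h] comp_assoc[OF i(2) j h] hj copairing_props[OF S f g] by simp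
qed

text \<open>The start map \<open>d0\<close> of the path object is a trivial fibration, so the
  cofibration \<open>j\<close> lifts against it. The lift is a map from the cylinder to the path
  object, and its end map is the required homotopy.\<close>

lemma fib_homotopic_imp_cofib_homotopic:
  assumes Y: "star_fibrant C Fib Y" and f: "f \<in> hom C X Y" and g: "g \<in> hom C X Y"
    and S: "is_coproduct C X X S i1 i2"
    and j: "j \<in> cofibrations C W Fib" "j \<in> hom C S Z" and w: "w \<in> W" "w \<in> hom C Z X"
    and wj: "w \<cdot> j = copairing C i1 i2 (Id C X) (Id C X)"
    and fg: "fib_homotopic C W Fib f g"
  shows "cofib_homotopic C W (cofibrations C W Fib) f g"
proof -
  obtain X' Y' R p1 p2 P s q H where
    f': "f \<in> hom C X' Y'" and R': "is_product C Y' Y' R p1 p2"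
    and s': "s \<in> W" "s \<in> hom C Y' P" and q: "q \<in> Fib" "q \<in> hom C P R"
    and qs': "q \<cdot> s = pairing C p1 p2 (Id C Y') (Id C Y')"
    and H': "H \<in> hom C X' P" and qH: "q \<cdot> H = pairing C p1 p2 f g"
    using fg unfolding fib_homotopic_def by blast
  have "X' = X" "Y' = Y"
    using f f' unfolding hom_def by auto
  note R = R'[unfolded \<open>Y' = Y\<close>] and s = s'[unfolded \<open>Y' = Y\<close>] and H = H'[unfolded \<open>X' = X\<close>]
    and qs = qs'[unfolded \<open>Y' = Y\<close>]
  have p: "p1 \<in> hom C R Y" "p2 \<in> hom C R Y"
    using R unfolding is_product_def by auto
  have i: "i1 \<in> hom C X S" "i2 \<in> hom C X S"
    using S unfolding is_coproduct_def by auto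
  have Xid: "Id C X \<in> hom C X X"
    using id_hom hom_objs[OF f] by blast
  define d0 where "d0 = p1 \<cdot> q"
  define d1 where "d1 = p2 \<cdot> q"
  note proj = path_object_projection[OF Y R s(2,1) q(2,1) qs, folded d0_def d1_def]
  have d0: "d0 \<in> hom C P Y" "d0 \<in> W" "d0 \<in> Fib" "d0 \<cdot> s = Id C Y"
    and d1: "d1 \<in> hom C P Y" "d1 \<cdot> s = Id C Y"
    using proj by auto
  have d0H: "d0 \<cdot> H = f" and d1H: "d1 \<cdot> H = g"
    unfolding d0_def d1_def
    using comp_assoc[OF H q(2) p(1)] comp_assoc[OF H q(2) p(2)] qH pairing_props[OF R f g]
    by simp_all
  have sf: "s \<cdot> f \<in> hom C X P"
    using comp_hom[OF f s(2)] .
  have d0sf: "d0 \<cdot> (s \<cdot> f) = f" and d1sf: "d1 \<cdot> (s \<cdot> f) = f"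
    using comp_assoc[OF f s(2) d0(1)] comp_assoc[OF f s(2) d1(1)] d0 d1 comp_id_left[OF f]
    by simp_all
  \<comment> \<open>On the first end of the cylinder the constant path at \<open>f\<close>, on the
    second the homotopy \<open>H\<close> from \<open>f\<close> to \<open>g\<close>. Both start at
    \<open>f\<close>, so \<open>d0 u\<close> extends over the cylinder as
    \<open>f w\<close>.\<close>
  define u where "u = copairing C i1 i2 (s \<cdot> f) H"
  have u: "u \<in> hom C S P" "u \<cdot> i1 = s \<cdot> f" "u \<cdot> i2 = H"
    unfolding u_def using copairing_props[OF S sf H] by auto
  note fold = copairing_props[OF S Xid Xid]
  have fw: "f \<cdot> w \<in> hom C Z Y"
    using comp_hom[OF w(2) f] .
  have fwj: "(f \<cdot> w) \<cdot> j = f \<cdot> copairing C i1 i2 (Id C X) (Id C X)"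
    using comp_assoc[OF j(2) w(2) f] wj by simp
  have "d0 \<cdot> u = (f \<cdot> w) \<cdot> j"
  proof (rule coproduct_unique[OF S comp_hom[OF u(1) d0(1)] comp_hom[OF j(2) fw]])
    show "(d0 \<cdot> u) \<cdot> i1 = ((f \<cdot> w) \<cdot> j) \<cdot> i1"
      unfolding fwj using comp_assoc[OF i(1) u(1) d0(1)] comp_assoc[OF i(1) fold(1) f]
        u d0sf fold comp_id_right[OF f] by simp
    show "(d0 \<cdot> u) \<cdot> i2 = ((f \<cdot> w) \<cdot> j) \<cdot> i2"
      unfolding fwj using comp_assoc[OF i(2) u(1) d0(1)] comp_assoc[OF i(2) fold(1) f]
        u d0H fold comp_id_right[OF f] by simp
  qed
  moreover have "left_lifting C j d0"
    using j d0 unfolding cofibrations_def by blast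
  moreover have "Dom C j = S" "Cod C j = Z" "Dom C d0 = P" "Cod C d0 = Y"
    using j(2) d0(1) unfolding hom_def by auto
  ultimately obtain l where l: "l \<in> hom C Z P" "l \<cdot> j = u"
    using u(1) fw unfolding left_lifting_def by auto
  \<comment> \<open>Taking ends of paths turns \<open>s f\<close> into \<open>f\<close> and
    \<open>H\<close> into \<open>g\<close>.\<close>
  have h: "d1 \<cdot> l \<in> hom C Z Y"
    using comp_hom[OF l(1) d1(1)] .
  note fgp = copairing_props[OF S f g]
  have "(d1 \<cdot> l) \<cdot> j = copairing C i1 i2 f g"
  proof (rule coproduct_unique[OF S comp_hom[OF j(2) h] fgp(1)])
    have eq: "(d1 \<cdot> l) \<cdot> j = d1 \<cdot> u"
      using comp_assoc[OF j(2) l(1) d1(1)] l(2) by simp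
    show "((d1 \<cdot> l) \<cdot> j) \<cdot> i1 = copairing C i1 i2 f g \<cdot> i1"
      unfolding eq fgp using comp_assoc[OF i(1) u(1) d1(1)] u d1sf by simp
    show "((d1 \<cdot> l) \<cdot> j) \<cdot> i2 = copairing C i1 i2 f g \<cdot> i2"
      unfolding eq fgp using comp_assoc[OF i(2) u(1) d1(1)] u d1H by simp
  qed
  then show ?thesis
    unfolding cofib_homotopic_def using f g S j w wj h by blast
qed

end

theorem proposition6p10:
  fixes F :: "('o, 'm) cat" and W Fib :: "'m set" and X Y :: 'o and f g :: 'm
  assumes "fibration_category F W Fib"
    and "\<forall>A \<in> Obj F. cofibrant F W Fib A \<and> star_fibrant F Fib A"
    and "\<forall>a \<in> Arr F. a \<in> W \<longleftrightarrow> homotopy_equivalence F W Fib a"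
    and "\<exists>e. initial_object F e"
    and "\<forall>A B D. \<forall>i \<in> cofibrations F W Fib \<inter> hom F D A. \<forall>b \<in> hom F D B.
           \<exists>p q. is_pushout F i b p q"
    and "\<forall>A S i1 i2. is_coproduct F A A S i1 i2 \<longrightarrow>
           (\<exists>Z. \<exists>j \<in> cofibrations F W Fib \<inter> hom F S Z. \<exists>w \<in> W \<inter> hom F Z A.
              w \<cdot>\<^bsub>F\<^esub> j = copairing F i1 i2 (Id F A) (Id F A))"
    and "f \<in> hom F X Y" and "g \<in> hom F X Y"
  shows "cofib_homotopic F W (cofibrations F W Fib) f g \<longleftrightarrow> fib_homotopic F W Fib f g"
proof -
  interpret fibration_category F W Fib
    by (fact assms(1))
  have XY: "X \<in> Obj F" "Y \<in> Obj F"
    using hom_objs[OF assms(7)] by auto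
  have cof: "cofibrant F W Fib A" and fib: "star_fibrant F Fib A" if "A \<in> Obj F" for A
    using assms(2) that by auto
  have he: "homotopy_equivalence F W Fib a" if "a \<in> W" for a
    using assms(3) W_arr that by blast
  obtain e where e: "initial_object F e"
    using assms(4) by blast
  then obtain i where i: "i \<in> hom F e X"
    using XY unfolding initial_object_def by blast
  \<comment> \<open>The coproduct of \<open>X\<close> with itself is the pushout of \<open>i\<close>
    along itself, which exists because \<open>i\<close> is a cofibration. The factorization
    hypothesis then gives a cylinder on this coproduct.\<close>
  obtain i1 i2 where "is_pushout F i i i1 i2"
    using assms(5) initial_cofibration[OF e cof[OF XY(1)] i] i by blast
  then obtain S where S: "is_coproduct F X X S i1 i2"
    using pushout_is_coproduct[OF e i i] by blast
  then obtain Z j w where j: "j \<in> cofibrations F W Fib" "j \<in> hom F S Z"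
    and w: "w \<in> W" "w \<in> hom F Z X"
    and wj: "w \<cdot>\<^bsub>F\<^esub> j = copairing F i1 i2 (Id F X) (Id F X)"
    using assms(6) by blast
  show ?thesis
    using cofib_homotopic_imp_fib_homotopic[OF cof fib he]
      fib_homotopic_imp_cofib_homotopic[OF fib[OF XY(2)] assms(7,8) S j w wj]
    by blast
qed

end
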